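(* For the uniform case of decremental sets, the algorithm UniRand, which at each step (if some item is pending) collects one of the pending items chosen uniformly at random, is $\mathrm{e}/(\mathrm{e}-1)$-competitive against an oblivious adversary.
   Context: Dynamic set problem: items with weights; time proceeds in steps; before each step items may be inserted into or deleted from a dynamic set $\mathcal{S}$; an item is active if inserted and not yet deleted; at each step an algorithm may collect at most one active item it has not collected before (such items are pending); the gain is the total weight collected. Uniform case: all items have weight $1$. Decremental: all items are inserted before the first step, afterwards only deletions occur. A randomized online algorithm is $R$-competitive against an oblivious adversary if for every instance $I$ (fixed in advance) its expected gain is at least $\mathrm{OPT}(I)/R$, where $\mathrm{OPT}(I)$ is the maximum achievable gain on $I$. *)

theory Defs
  imports "HOL-Probability.Probability_Mass_Function"
begin

datatype 'a update = Insert 'a | Delete 'a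

text \<open>An instance lists, for each step, the finite batch of updates applied just before that step.
  Its length is the number of steps.\<close>

type_synonym 'a dyn_instance = "'a update list list"

fun apply_update :: "'a update \<Rightarrow> 'a set \<Rightarrow> 'a set" where
  "apply_update (Insert x) S = insert x S"
| "apply_update (Delete x) S = S - {x}"

definition active :: "'a update list list \<Rightarrow> 'a set" where
  "active h = fold apply_update (concat h) {}"

text \<open>The past choices of an algorithm are a list with one entry per step:
  \<open>Some x\<close> if item \<open>x\<close> was collected, \<open>None\<close> if the step was idle.\<close>

definition collected :: "'a option list \<Rightarrow> 'a set" where
  "collected c = {x. Some x \<in> set c}"

definition pending :: "'a update list list \<Rightarrow> 'a option list \<Rightarrow> 'a set" where
  "pending h c = active h - collected c"

definition gain :: "('a \<Rightarrow> real) \<Rightarrow> 'a option list \<Rightarrow> real" where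
  "gain w c = (\<Sum>x\<in>collected c. w x)"

definition feasible :: "'a dyn_instance \<Rightarrow> 'a option list \<Rightarrow> bool" where
  "feasible I c \<longleftrightarrow> length c = length I \<and>
     (\<forall>t<length I. \<forall>x. c ! t = Some x \<longrightarrow> x \<in> pending (take (Suc t) I) (take t c))"

definition OPT :: "('a \<Rightarrow> real) \<Rightarrow> 'a dyn_instance \<Rightarrow> real" where
  "OPT w I = Max (gain w ` {c. feasible I c})"

text \<open>A randomized algorithm sees only the batches presented so far (the current one included) and
  its own past choices, and returns a distribution on its next choice.\<close>

type_synonym 'a algorithm = "'a update list list \<Rightarrow> 'a option list \<Rightarrow> 'a option pmf"

definition online_algorithm :: "'a algorithm \<Rightarrow> bool" where
  "online_algorithm A \<longleftrightarrow> (\<forall>h c. set_pmf (A h c) \<subseteq> insert None (Some ` pending h c))"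

primrec run :: "'a algorithm \<Rightarrow> 'a dyn_instance \<Rightarrow> nat \<Rightarrow> 'a option list pmf" where
  "run A I 0 = return_pmf []"
| "run A I (Suc t) =
     bind_pmf (run A I t) (\<lambda>c. map_pmf (\<lambda>z. c @ [z]) (A (take (Suc t) I) c))"

definition expected_gain :: "('a \<Rightarrow> real) \<Rightarrow> 'a algorithm \<Rightarrow> 'a dyn_instance \<Rightarrow> real" where
  "expected_gain w A I = measure_pmf.expectation (run A I (length I)) (gain w)"

text \<open>The adversary is oblivious: the instance is fixed before the random choices are made.\<close>

definition competitive_on ::
  "'a dyn_instance set \<Rightarrow> ('a \<Rightarrow> real) \<Rightarrow> real \<Rightarrow> 'a algorithm \<Rightarrow> bool" where
  "competitive_on \<I> w R A \<longleftrightarrow>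
     online_algorithm A \<and> (\<forall>I\<in>\<I>. expected_gain w A I \<ge> OPT w I / R)"

definition decremental :: "'a dyn_instance \<Rightarrow> bool" where
  "decremental I \<longleftrightarrow> (\<forall>B\<in>set (tl I). \<forall>x. Insert x \<notin> set B)"

definition unirand :: "'a algorithm" where
  "unirand h c = (let P = pending h c in
     if P = {} then return_pmf None else map_pmf Some (pmf_of_set P))"

text \<open>The maximum in \<^const>\<open>OPT\<close> ranges over a finite nonempty set, and the uniform distribution
  in \<^const>\<open>unirand\<close> over a finite one.\<close>

lemma finite_active: "finite (active h)"
proof -
  have "finite (fold apply_update us S)" if "finite S" for us and S :: "'a set"
    using that
  proof (induction us arbitrary: S)
    case (Cons u us)
    then show ?case by (cases u) auto
  qed simp
  then show ?thesis by (simp add: active_def)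
qed

lemma finite_pending: "finite (pending h c)"
  by (simp add: pending_def finite_active)

lemma feasible_idle: "feasible I (replicate (length I) None)"
  by (simp add: feasible_def)

lemma finite_feasible: "finite {c. feasible I c}"
proof (rule finite_subset)
  let ?X = "insert None (Some ` (\<Union>t\<le>length I. active (take t I)))"
  show "{c. feasible I c} \<subseteq> {c. set c \<subseteq> ?X \<and> length c = length I}"
  proof (clarsimp, intro conjI)
    fix c assume c: "feasible I c"
    then show "length c = length I" by (simp add: feasible_def)
    show "set c \<subseteq> ?X"
    proof
      fix z assume "z \<in> set c"
      then obtain t where t: "t < length I" "z = c ! t"
        using c by (auto simp: in_set_conv_nth feasible_def)
      show "z \<in> ?X"
      proof (cases z)
        case (Some x)
        then have "x \<in> active (take (Suc t) I)"
          using c t by (auto simp: feasible_def pending_def)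
        then show ?thesis using Some t by (auto intro!: imageI UN_I[of "Suc t"])
      qed simp
    qed
  qed
  show "finite {c. set c \<subseteq> ?X \<and> length c = length I}"
    by (intro finite_lists_length_eq) (simp add: finite_active)
qed

lemma online_algorithm_unirand: "online_algorithm unirand"
  by (auto simp: online_algorithm_def unirand_def Let_def finite_pending)

end

theory Submission imports Defs begin

text \<open>Only the items of an optimal solution matter, since additional pending items never hurt
  the uniform random choice. Listed in the order in which the optimum collects them, the \<open>k\<close>-th
  of these \<open>m\<close> items is active at least up to step \<open>k\<close>, so one may pretend that exactly one of them
  expires after each step. For a uniformly random set of \<open>u\<close> uncollected items out of \<open>a\<close> remaining
  ones, the expected gain then satisfies a recursion of which \<open>a (1 - (1 - 1/a) ^ u)\<close> is a
  subsolution, by convexity of powers. At \<open>u = a = m\<close> this is at least \<open>(1 - 1/e) m\<close>.\<close>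

section \<open>Expected gain of uniform random choices\<close>

text \<open>\<open>uniform_gain As P\<close> is the expected number of items that are collected when the active sets
  of the remaining steps are \<open>As\<close> and \<open>P\<close> is the (possibly infinite) set of uncollected items.\<close>

primrec uniform_gain :: "'a set list \<Rightarrow> 'a set \<Rightarrow> real" where
  "uniform_gain [] P = 0"
| "uniform_gain (A # As) P =
     (if P \<inter> A = {} then uniform_gain As P
      else 1 + (\<Sum>x\<in>P \<inter> A. uniform_gain As (P - {x})) / real (card (P \<inter> A)))"

lemma uniform_gain_nonneg: "uniform_gain As P \<ge> 0"
  by (induction As arbitrary: P) (auto intro!: add_nonneg_nonneg divide_nonneg_nonneg sum_nonneg)

text \<open>Induction over the steps. If \<open>y\<close> competes with other pending items,
  choosing \<open>y\<close> leaves \<open>P\<close>, worth at least the average over the sets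
  \<open>P - {x}\<close>; the other choices keep their relative chances and leave \<open>y\<close>
  in addition.\<close>

lemma uniform_gain_insert:
  assumes "\<forall>A\<in>set As. finite A"
  shows "uniform_gain As P \<le> uniform_gain As (insert y P)"
  using assms
proof (induction As arbitrary: P y)
  case (Cons A As)
  note IH = Cons.IH
  have fin: "finite (P \<inter> A)" and As: "\<forall>A\<in>set As. finite A" using Cons.prems by auto
  let ?V = "uniform_gain As"
  consider "y \<in> P" | "y \<notin> P" "y \<notin> A" | "y \<notin> P" "y \<in> A" "P \<inter> A = {}"
    | "y \<notin> P" "y \<in> A" "P \<inter> A \<noteq> {}" by blast
  then show ?case
  proof cases
    case 1
    then show ?thesis by (simp add: insert_absorb)
  next
    case 2
    have "?V (P - {x}) \<le> ?V (insert y P - {x})" if "x \<in> P \<inter> A" for x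
      using IH[OF As, of "P - {x}"] that 2 by (simp add: insert_Diff_if)
    then show ?thesis using 2 IH[OF As] by (auto intro!: divide_right_mono sum_mono)
  next
    case 3
    then show ?thesis using 3 by simp
  next
    case 4
    define n where "n = real (card (P \<inter> A))"
    have n: "n > 0" using fin 4 by (simp add: n_def card_gt_0_iff)
    define S where "S = (\<Sum>x\<in>P \<inter> A. ?V (P - {x}))"
    have "?V (P - {x}) \<le> ?V P" if "x \<in> P \<inter> A" for x
      using IH[OF As, of "P - {x}" x] that by (simp add: insert_absorb)
    then have S: "S \<le> n * ?V P"
      unfolding S_def n_def using sum_bounded_above[of "P \<inter> A" "\<lambda>x. ?V (P - {x})" "?V P"] by simp
    have "?V (P - {x}) \<le> ?V (insert y P - {x})" if "x \<in> P \<inter> A" for x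
      using IH[OF As, of "P - {x}"] that 4 by (auto simp: insert_Diff_if)
    then have "S \<le> (\<Sum>x\<in>P \<inter> A. ?V (insert y P - {x}))" (is "_ \<le> ?T")
      unfolding S_def by (rule sum_mono)
    have "uniform_gain (A # As) (insert y P) = 1 + (?V P + ?T) / (n + 1)"
      using 4 fin by (simp add: n_def add.commute)
    \<comment> \<open>\<open>?V P\<close> is at least the mean \<open>S / n\<close>, so averaging it
      in does not lower the mean.\<close>
    moreover have "S / n \<le> (?V P + S) / (n + 1)"
      using S n by (simp add: field_simps)
    moreover have "(?V P + S) / (n + 1) \<le> (?V P + ?T) / (n + 1)"
      using \<open>S \<le> ?T\<close> n by (intro divide_right_mono) auto
    moreover have "uniform_gain (A # As) P = 1 + S / n"
      using 4 by (simp add: S_def n_def)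
    ultimately show ?thesis by linarith
  qed
qed simp

lemma uniform_gain_remove:
  assumes "\<forall>A\<in>set As. finite A"
  shows "uniform_gain As (P - {y}) \<le> uniform_gain As P"
  using uniform_gain_insert[OF assms, of "P - {y}" y] uniform_gain_insert[OF assms, of P y]
  by (cases "y \<in> P") (auto simp: insert_absorb)

text \<open>Items that are never active have no influence, so an infinite set such as
  \<open>UNIV\<close> can be cut down to a finite one.\<close>

lemma uniform_gain_Int:
  assumes "\<Union> (set As) \<subseteq> B"
  shows "uniform_gain As (P \<inter> B) = uniform_gain As P"
  using assms
proof (induction As arbitrary: P)
  case (Cons A As)
  have "P \<inter> B \<inter> A = P \<inter> A" using Cons.prems by auto
  moreover have "uniform_gain As (P \<inter> B - {x}) = uniform_gain As (P - {x})" for x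
    using Cons.IH[of "P - {x}"] Cons.prems by (simp add: Int_Diff Diff_Int_distrib2 Int_commute)
  ultimately show ?case using Cons by simp
qed simp

text \<open>Inserting items one by one bridges only finite differences, so both sets are first cut
  down to \<open>B\<close>. With \<open>Q = UNIV\<close> this allows the analysis to ignore items
  outside an optimal solution.\<close>

lemma uniform_gain_mono:
  assumes fin: "\<forall>A\<in>set As. finite A" and "P \<subseteq> Q"
  shows "uniform_gain As P \<le> uniform_gain As Q"
proof -
  define B where "B = \<Union> (set As)"
  have "finite (Q \<inter> B)" using fin by (auto simp: B_def)
  have aux: "uniform_gain As R \<le> uniform_gain As (R \<union> F)" if "finite F" for R F
    using that
  proof induction
    case (insert x F)
    then show ?case using uniform_gain_insert[OF fin, of "R \<union> F" x] by simp
  qed simp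
  have "uniform_gain As (P \<inter> B) \<le> uniform_gain As (P \<inter> B \<union> Q \<inter> B)"
    using \<open>finite (Q \<inter> B)\<close> by (rule aux)
  also have "P \<inter> B \<union> Q \<inter> B = Q \<inter> B" using assms(2) by blast
  finally show ?thesis by (simp add: uniform_gain_Int B_def)
qed

section \<open>Averaging over subsets of fixed size\<close>

lemma finite_subsets_of_card: "finite B \<Longrightarrow> finite {P. P \<subseteq> B \<and> card P = k}"
  by (rule finite_subset[of _ "Pow B"]) auto

text \<open>Double counting: each \<open>Q\<close> arises from the \<open>card B - k\<close>
  elements outside it. In other words, deleting a random element of a random set of fixed size
  leaves a uniformly random set of the next smaller size.\<close>

lemma sum_subsets_remove:
  fixes f :: "'a set \<Rightarrow> real"
  assumes B: "finite B"
  shows "(\<Sum>P | P \<subseteq> B \<and> card P = Suc k. \<Sum>y\<in>P. f (P - {y}))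
       = real (card B - k) * (\<Sum>Q | Q \<subseteq> B \<and> card Q = k. f Q)"
proof -
  let ?S = "\<lambda>k. {P. P \<subseteq> B \<and> card P = k}"
  have fin: "finite P" if "P \<in> ?S j" for P j using that B finite_subset by auto
  have "(\<Sum>P\<in>?S (Suc k). \<Sum>y\<in>P. f (P - {y})) = (\<Sum>(P, y)\<in>Sigma (?S (Suc k)) (\<lambda>P. P). f (P - {y}))"
    using finite_subsets_of_card[OF B] fin by (intro sum.Sigma ballI)
  also have "\<dots> = (\<Sum>(Q, y)\<in>Sigma (?S k) (\<lambda>Q. B - Q). f Q)"
  proof (rule sum.reindex_bij_witness[of _ "\<lambda>(Q, y). (insert y Q, y)" "\<lambda>(P, y). (P - {y}, y)"])
    fix p assume "p \<in> Sigma (?S (Suc k)) (\<lambda>P. P)"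
    then obtain P y where p: "p = (P, y)" "P \<subseteq> B" "card P = Suc k" "y \<in> P" by blast
    show "(case case p of (P, y) \<Rightarrow> (P - {y}, y) of (Q, y) \<Rightarrow> (insert y Q, y)) = p"
      using p by (simp add: insert_absorb)
    show "(case p of (P, y) \<Rightarrow> (P - {y}, y)) \<in> Sigma (?S k) (\<lambda>Q. B - Q)"
      using p by (auto simp: card_Diff_singleton)
    show "(case case p of (P, y) \<Rightarrow> (P - {y}, y) of (Q, y) \<Rightarrow> f Q) = (case p of (P, y) \<Rightarrow> f (P - {y}))"
      using p by simp
  next
    fix q assume "q \<in> Sigma (?S k) (\<lambda>Q. B - Q)"
    then obtain Q y where q: "q = (Q, y)" "Q \<subseteq> B" "card Q = k" "y \<in> B" "y \<notin> Q" by blast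
    then have "finite Q" using B finite_subset by blast
    show "(case case q of (Q, y) \<Rightarrow> (insert y Q, y) of (P, y) \<Rightarrow> (P - {y}, y)) = q"
      using q by simp
    show "(case q of (Q, y) \<Rightarrow> (insert y Q, y)) \<in> Sigma (?S (Suc k)) (\<lambda>P. P)"
      using q \<open>finite Q\<close> by simp
  qed
  also have "\<dots> = (\<Sum>Q\<in>?S k. \<Sum>y\<in>B - Q. f Q)"
    using finite_subsets_of_card[OF B] B by (intro sum.Sigma[symmetric] ballI) simp_all
  also have "\<dots> = (\<Sum>Q\<in>?S k. real (card B - k) * f Q)"
    using fin by (intro sum.cong) (auto simp: card_Diff_subset)
  finally show ?thesis by (simp add: sum_distrib_left)
qed

text \<open>The sets are split by whether they contain \<open>x\<close>. This describes the expiry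
  of \<open>x\<close>: a set of size \<open>Suc k\<close> keeps its size or loses one item.\<close>

lemma sum_subsets_insert:
  fixes f :: "'a set \<Rightarrow> real"
  assumes B: "finite B" and x: "x \<notin> B"
  shows "(\<Sum>P | P \<subseteq> insert x B \<and> card P = Suc k. f (P - {x}))
       = (\<Sum>P | P \<subseteq> B \<and> card P = Suc k. f P) + (\<Sum>P | P \<subseteq> B \<and> card P = k. f P)"
proof -
  let ?S = "\<lambda>k. {P. P \<subseteq> B \<and> card P = k}"
  have fin: "finite P" if "P \<subseteq> B" for P using that B finite_subset by auto
  have nx: "x \<notin> P" if "P \<subseteq> B" for P using that x by auto
  have "{P. P \<subseteq> insert x B \<and> card P = Suc k} = ?S (Suc k) \<union> insert x ` ?S k" (is "?L = ?R")
  proof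
    show "?L \<subseteq> ?R"
    proof
      fix P assume P: "P \<in> ?L"
      show "P \<in> ?R"
      proof (cases "x \<in> P")
        case True
        then have "P = insert x (P - {x})" "P - {x} \<in> ?S k"
          using P by (auto simp: card_Diff_singleton)
        then show ?thesis by blast
      qed (use P in auto)
    qed
    show "?R \<subseteq> ?L" using fin nx by (auto simp: card_insert_if)
  qed
  then have "(\<Sum>P | P \<subseteq> insert x B \<and> card P = Suc k. f (P - {x}))
      = (\<Sum>P\<in>?S (Suc k). f (P - {x})) + (\<Sum>P\<in>insert x ` ?S k. f (P - {x}))"
    using x B by (simp only:, intro sum.union_disjoint) (auto intro: finite_subsets_of_card)
  also have "(\<Sum>P\<in>insert x ` ?S k. f (P - {x})) = (\<Sum>P\<in>?S k. f (insert x P - {x}))"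
  proof (subst sum.reindex)
    show "inj_on (insert x) (?S k)" using nx by (auto simp: inj_on_def insert_ident)
  qed simp
  also have "\<dots> = (\<Sum>P\<in>?S k. f P)" using nx by (intro sum.cong) auto
  also have "(\<Sum>P\<in>?S (Suc k). f (P - {x})) = (\<Sum>P\<in>?S (Suc k). f P)"
    using nx by (intro sum.cong) auto
  finally show ?thesis .
qed

section \<open>A closed-form subsolution of the gain recursion\<close>

text \<open>Convexity: the left side is the tangent at \<open>s\<close> to the power function with
  exponent \<open>Suc k\<close>, evaluated at \<open>r\<close>.\<close>

lemma power_tangent_le:
  fixes r s :: real
  assumes "0 \<le> r" "0 \<le> s"
  shows "s ^ k * (s + real (Suc k) * (r - s)) \<le> r ^ Suc k"
proof (induction k)
  case (Suc k)
  have "s ^ Suc k * (s + real (Suc (Suc k)) * (r - s))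
      = r * (s ^ k * (s + real (Suc k) * (r - s))) - real (Suc k) * s ^ k * (r - s)\<^sup>2"
    by (simp add: algebra_simps power2_eq_square)
  also have "\<dots> \<le> r * (s ^ k * (s + real (Suc k) * (r - s)))"
    using assms by simp
  also have "\<dots> \<le> r * r ^ Suc k" using Suc assms by (intro mult_left_mono)
  finally show ?case by simp
qed simp

text \<open>For \<open>a > 0\<close> this is the expected number of occupied bins when
  \<open>u\<close> balls are thrown independently and uniformly into \<open>a\<close> bins.\<close>

definition gain_bound :: "nat \<Rightarrow> nat \<Rightarrow> real" where
  "gain_bound u a = real a * (1 - (1 - 1 / real a) ^ u)"

text \<open>With \<open>w + 2\<close> uncollected items out of \<open>b + 1\<close>, one is
  collected; the expiring item is among the \<open>w + 1\<close> left with probability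
  \<open>(w + 1) / (b + 1)\<close>. After expansion this is the tangent inequality for the bases
  \<open>r\<close> and \<open>s\<close>.\<close>

lemma gain_bound_step:
  assumes "Suc w \<le> b"
  shows "gain_bound (Suc (Suc w)) (Suc b) \<le>
    1 + (real b - real w) / real (Suc b) * gain_bound (Suc w) b
      + real (Suc w) / real (Suc b) * gain_bound w b"
proof -
  define r where "r = 1 - 1 / real (Suc b)"
  define s where "s = 1 - 1 / real b"
  have b: "b > 0" using assms by simp
  then have rs: "0 \<le> r" "0 \<le> s" by (simp_all add: r_def s_def)
  have ar: "real (Suc b) * r = real b" by (simp add: r_def field_simps)
  \<comment> \<open>This turns the slope term of the tangent into the expiry probability.\<close>
  have diff: "real b * (r - s) = 1 / real (Suc b)"
    using b by (simp add: r_def s_def right_diff_distrib) (simp add: field_simps)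
  have bw: "(real b - real w) / real (Suc b) = 1 - real (Suc w) / real (Suc b)"
    by (simp add: field_simps)
  have "real b * (s ^ w * (s + real (Suc w) * (r - s))) \<le> real b * r ^ Suc w"
    using power_tangent_le[OF rs] by (intro mult_left_mono) auto
  also have "real b * r ^ Suc w = real (Suc b) * r ^ Suc (Suc w)"
    by (metis ar mult.assoc power_Suc)
  also have "real b * (s ^ w * (s + real (Suc w) * (r - s)))
      = s ^ w * (real b * s + real (Suc w) * (real b * (r - s)))"
    by (simp add: algebra_simps)
  also have "\<dots> = s ^ w * (real b * s + real (Suc w) / real (Suc b))"
    unfolding diff by simp
  finally have main: "s ^ w * (real b * s + real (Suc w) / real (Suc b))
      \<le> real (Suc b) * r ^ Suc (Suc w)" .
  define q where "q = real (Suc w) / real (Suc b)"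
  have bs: "real b * s = real b - 1" using b by (simp add: s_def field_simps)
  have "1 + (1 - q) * (real b * (1 - s ^ Suc w)) + q * (real b * (1 - s ^ w))
      = real (Suc b) - s ^ w * ((1 - q) * (real b * s) + q * real b)"
    by (simp add: algebra_simps)
  also have "\<dots> = real (Suc b) - s ^ w * (real b * s + q)"
    unfolding bs by (simp add: algebra_simps)
  finally show ?thesis
    using main unfolding gain_bound_def bw r_def[symmetric] s_def[symmetric] q_def[symmetric]
    by (simp add: right_diff_distrib)
qed

text \<open>The bound concerns the sum over all \<open>u\<close>-subsets because a random collection
  maps uniformly random sets to uniformly random sets, which gives a recursion for averages. In the
  induction, the head \<open>x\<close> is the item treated as expiring after the current
  step.\<close>

lemma sum_uniform_gain_ge:
  assumes "\<forall>A\<in>set As. finite A" and "distinct xs"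
    and "\<And>k. k < length xs \<Longrightarrow> k < length As \<and> set (drop k xs) \<subseteq> As ! k"
  shows "real (length xs choose u) * gain_bound u (length xs)
    \<le> (\<Sum>P | P \<subseteq> set xs \<and> card P = u. uniform_gain As P)"
  using assms
proof (induction xs arbitrary: As u)
  case Nil
  then show ?case by (auto simp: gain_bound_def intro!: sum_nonneg uniform_gain_nonneg)
next
  case (Cons x ys)
  obtain A As' where As: "As = A # As'" using Cons.prems(3)[of 0] by (cases As) auto
  have A: "insert x (set ys) \<subseteq> A" using Cons.prems(3)[of 0] by (simp add: As)
  define b where "b = length ys"
  define w where "w = u - 2"
  have ys: "finite (set ys)" "x \<notin> set ys" "card (set ys) = b"
    using Cons.prems(2) by (auto simp: b_def distinct_card)
  have fin: "\<forall>A\<in>set As'. finite A" using Cons.prems(1) by (simp add: As)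
  have IH: "real (b choose v) * gain_bound v b
      \<le> (\<Sum>P | P \<subseteq> set ys \<and> card P = v. uniform_gain As' P)" for v
    unfolding b_def
  proof (rule Cons.IH[OF fin])
    show "distinct ys" using Cons.prems(2) by simp
    show "k < length As' \<and> set (drop k ys) \<subseteq> As' ! k" if "k < length ys" for k
      using Cons.prems(3)[of "Suc k"] that by (simp add: As)
  qed
  let ?S = "\<lambda>k. {P. P \<subseteq> insert x (set ys) \<and> card P = k}"
  have card_S: "card (?S k) = Suc b choose k" for k
    using n_subsets[of "insert x (set ys)" k] ys by simp
  have gain: "uniform_gain As P = 1 + (\<Sum>y\<in>P. uniform_gain As' (P - {y})) / real k"
    if "P \<in> ?S k" "k > 0" for P k
  proof -
    have "P \<inter> A = P" "P \<noteq> {}" using that A by auto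
    then show ?thesis using that by (simp add: As)
  qed
  have sum_nn: "0 \<le> (\<Sum>P\<in>?S u. uniform_gain As P)"
    by (intro sum_nonneg uniform_gain_nonneg)
  \<comment> \<open>The recursion needs \<open>u\<close> between 2 and \<open>b + 1\<close>. In the
    first case the left side vanishes; for \<open>u = 1\<close> the single item is collected at
    once.\<close>
  consider "u = 0 \<or> Suc b < u" | "u = 1" | "u = Suc (Suc w)" "Suc w \<le> b"
    unfolding w_def by linarith
  then show ?case
  proof cases
    case 1
    then have "real (Suc b choose u) * gain_bound u (Suc b) = 0"
      by (auto simp: gain_bound_def binomial_eq_0)
    then have "real (Suc b choose u) * gain_bound u (Suc b) \<le> (\<Sum>P\<in>?S u. uniform_gain As P)"
      using sum_nn by (simp only:)
    then show ?thesis by (simp add: b_def)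
  next
    case 2
    have "1 \<le> uniform_gain As P" if "P \<in> ?S 1" for P
      using gain[OF that] by (auto intro!: sum_nonneg uniform_gain_nonneg)
    then have "(\<Sum>P\<in>?S 1. 1) \<le> (\<Sum>P\<in>?S 1. uniform_gain As P)" by (rule sum_mono)
    moreover have "gain_bound 1 (Suc b) = 1" by (simp add: gain_bound_def)
    ultimately show ?thesis using 2 card_S[of 1] by (simp add: b_def)
  next
    case 3
    define c where "c = real (b choose w)"
    define D where "D = real (Suc b choose Suc (Suc w))"
    have wb: "real b - real w = real (b - w)" using 3 by simp
    \<comment> \<open>Both binomials are expressed through \<open>c\<close>, so that the two terms
      of the recursion share the factor \<open>(b - w) / u\<close>.\<close>
    have c1: "real (b choose Suc w) = c * (real b - real w) / real (Suc w)"
    proof -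
      have "Suc w * (b choose Suc w) = (b - w) * (b choose w)"
        by (simp only: binomial_absorption binomial_absorb_comp)
      then have "real (Suc w) * real (b choose Suc w) = real (b - w) * c"
        unfolding c_def by (metis of_nat_mult)
      then show ?thesis unfolding wb by (simp add: eq_divide_eq mult.commute)
    qed
    have D: "D = c * real (Suc b) * (real b - real w) / (real (Suc w) * real (Suc (Suc w)))"
    proof -
      have "real (Suc (Suc w)) * D = real (Suc b) * real (b choose Suc w)"
        unfolding D_def using Suc_times_binomial[of "Suc w" b] by (metis of_nat_mult)
      then have "D = real (Suc b) * real (b choose Suc w) / real (Suc (Suc w))"
        by (simp add: eq_divide_eq mult.commute)
      then show ?thesis unfolding c1 by (simp add: mult_ac)
    qed
    have "D * gain_bound (Suc (Suc w)) (Suc b) \<le>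
      D * (1 + (real b - real w) / real (Suc b) * gain_bound (Suc w) b
        + real (Suc w) / real (Suc b) * gain_bound w b)"
      using gain_bound_step[OF 3(2)] by (intro mult_left_mono) (auto simp: D_def)
    also have "\<dots> = D + (real b - real w) / real u
        * (real (b choose Suc w) * gain_bound (Suc w) b + c * gain_bound w b)"
    proof -
      have "D * ((real b - real w) / real (Suc b))
          = (real b - real w) / real u * real (b choose Suc w)"
        unfolding D c1 3(1) by (simp add: divide_simps)
      moreover have "D * (real (Suc w) / real (Suc b)) = (real b - real w) / real u * c"
        unfolding D 3(1) by (simp add: divide_simps)
      ultimately show ?thesis
        by (simp only: distrib_left mult.assoc[symmetric] mult_1_right add.assoc)
    qed
    also have "\<dots> \<le> D + (real b - real w) / real u *
        ((\<Sum>P | P \<subseteq> set ys \<and> card P = Suc w. uniform_gain As' P)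
         + (\<Sum>P | P \<subseteq> set ys \<and> card P = w. uniform_gain As' P))"
      using IH[of "Suc w"] IH[of w] 3 by (intro add_left_mono mult_left_mono) (auto simp: c_def)
    also have "\<dots> = D + (real b - real w) / real u * (\<Sum>P\<in>?S (Suc w). uniform_gain As' (P - {x}))"
      using sum_subsets_insert[OF ys(1,2), where k = w and f = "uniform_gain As'"] by simp
    \<comment> \<open>The expiry is only pretended: putting \<open>x\<close> back can only raise the
      value.\<close>
    also have "\<dots> \<le> D + (real b - real w) / real u * (\<Sum>P\<in>?S (Suc w). uniform_gain As' P)"
      using 3 by (intro add_left_mono mult_left_mono sum_mono uniform_gain_remove[OF fin]) auto
    \<comment> \<open>Double counting absorbs \<open>b - w\<close>, the number of elements outside a
      set of size \<open>Suc w\<close>.\<close>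
    also have "\<dots> = D + (\<Sum>P\<in>?S u. \<Sum>y\<in>P. uniform_gain As' (P - {y})) / real u"
      using sum_subsets_remove[where B = "insert x (set ys)" and k = "Suc w" and f = "uniform_gain As'"] ys 3 by simp
    also have "\<dots> = (\<Sum>P\<in>?S u. 1 + (\<Sum>y\<in>P. uniform_gain As' (P - {y})) / real u)"
      using card_S[of u] 3 by (simp add: D_def sum.distrib sum_divide_distrib)
    also have "\<dots> = (\<Sum>P\<in>?S u. uniform_gain As P)"
      using gain 3 by (intro sum.cong) auto
    finally show ?thesis using 3 by (simp add: D_def b_def)
  qed
qed

text \<open>For \<open>u = m\<close> the only subset is \<open>set xs\<close>, so the averaged bound
  holds for this set itself; the constant comes from
  \<open>(1 - 1 / m) ^ m <= exp (- 1)\<close>.\<close>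

lemma uniform_gain_ge:
  assumes fin: "\<forall>A\<in>set As. finite A" and dist: "distinct xs"
    and chain: "\<And>k. k < length xs \<Longrightarrow> k < length As \<and> set (drop k xs) \<subseteq> As ! k"
  shows "real (length xs) * (1 - exp (- 1)) \<le> uniform_gain As (set xs)"
proof -
  define m where "m = length xs"
  have "P = set xs" if "P \<subseteq> set xs" "card P = m" for P
    using that dist by (intro card_subset_eq) (auto simp: m_def distinct_card)
  then have "{P. P \<subseteq> set xs \<and> card P = m} = {set xs}"
    using dist by (auto simp: m_def distinct_card)
  then have "gain_bound m m \<le> uniform_gain As (set xs)"
    using sum_uniform_gain_ge[OF fin dist chain, of m] by (simp add: m_def)
  moreover have "real m * (1 - exp (- 1)) \<le> gain_bound m m"
  proof (cases "m = 0")
    case False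
    then show ?thesis unfolding gain_bound_def
      using exp_ge_one_minus_x_over_n_power_n[of 1 m] by (intro mult_left_mono) auto
  qed (simp add: gain_bound_def)
  ultimately show ?thesis by (simp add: m_def)
qed

section \<open>The run of UniRand\<close>

definition active_sets :: "'a dyn_instance \<Rightarrow> 'a set list" where
  "active_sets I = map (\<lambda>t. active (take (Suc t) I)) [0..<length I]"

lemma length_active_sets [simp]: "length (active_sets I) = length I"
  by (simp add: active_sets_def)

lemma nth_active_sets [simp]: "t < length I \<Longrightarrow> active_sets I ! t = active (take (Suc t) I)"
  by (simp add: active_sets_def)

lemma finite_active_sets: "\<forall>A\<in>set (active_sets I). finite A"
  by (auto simp: active_sets_def finite_active)

lemma collected_Nil [simp]: "collected [] = {}"
  by (simp add: collected_def)

lemma collected_snoc_None [simp]: "collected (c @ [None]) = collected c"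
  by (simp add: collected_def)

lemma collected_snoc_Some [simp]: "collected (c @ [Some x]) = insert x (collected c)"
  by (auto simp: collected_def)

lemma finite_collected: "finite (collected c)"
proof -
  have "collected c = Some -` set c" by (auto simp: collected_def)
  then show ?thesis by (simp add: finite_vimageI)
qed

lemma finite_set_pmf_unirand: "finite (set_pmf (unirand h c))"
  by (simp add: unirand_def Let_def finite_pending)

lemma finite_set_pmf_run_unirand: "finite (set_pmf (run unirand I t))"
  by (induction t) (auto simp: finite_set_pmf_unirand)

text \<open>\<open>F\<close>, the gain so far plus the expected gain to come, is a martingale along
  the run, by the recursion of \<open>uniform_gain\<close>.\<close>

lemma expectation_unirand_step:
  fixes I :: "'a dyn_instance"
  assumes t: "t < length I"
  defines "F \<equiv> \<lambda>t c. real (card (collected c)) + uniform_gain (drop t (active_sets I)) (- collected c)"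
  shows "measure_pmf.expectation (unirand (take (Suc t) I) c) (\<lambda>z. F (Suc t) (c @ [z])) = F t c"
proof -
  define Q where "Q = - collected c \<inter> active (take (Suc t) I)"
  have pending: "pending (take (Suc t) I) c = Q" by (auto simp: pending_def Q_def)
  have drop: "drop t (active_sets I) = active (take (Suc t) I) # drop (Suc t) (active_sets I)"
    using t by (simp add: Cons_nth_drop_Suc[symmetric])
  have fin: "finite Q" by (simp add: Q_def finite_active)
  show ?thesis
  proof (cases "Q = {}")
    case True
    then show ?thesis
      by (simp add: F_def drop unirand_def pending Q_def[symmetric])
  next
    case False
    let ?V = "\<lambda>x. uniform_gain (drop (Suc t) (active_sets I)) (- collected c - {x})"
    have F: "F (Suc t) (c @ [Some x]) = real (card (collected c)) + 1 + ?V x" if "x \<in> Q" for x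
    proof -
      have "- insert x (collected c) = - collected c - {x}" by auto
      then show ?thesis using that by (simp add: F_def finite_collected Q_def)
    qed
    have "measure_pmf.expectation (unirand (take (Suc t) I) c) (\<lambda>z. F (Suc t) (c @ [z]))
        = (\<Sum>x\<in>Q. F (Suc t) (c @ [Some x])) / card Q"
      using False fin by (simp add: unirand_def pending integral_pmf_of_set)
    also have "\<dots> = (\<Sum>x\<in>Q. real (card (collected c)) + 1 + ?V x) / card Q"
      using F by simp
    also have "\<dots> = real (card (collected c)) + 1 + (\<Sum>x\<in>Q. ?V x) / card Q"
      using False fin by (simp add: sum.distrib add_divide_distrib)
    also have "\<dots> = F t c"
      using False by (simp add: F_def drop Q_def[symmetric])
    finally show ?thesis .
  qed
qed

text \<open>The martingale is compared at its two ends: initially nothing is collected, hence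
  \<open>UNIV\<close>; finally no gain is to come and \<open>F\<close> is the realized gain.\<close>

lemma expected_gain_unirand:
  "expected_gain (\<lambda>_. 1) unirand I = uniform_gain (active_sets I) UNIV"
proof -
  define F where "F \<equiv> \<lambda>t c. real (card (collected c))
    + uniform_gain (drop t (active_sets I)) (- collected c)"
  have "measure_pmf.expectation (run unirand I t) (F t) = F 0 []" if "t \<le> length I" for t
    using that
  proof (induction t)
    case (Suc t)
    let ?p = "run unirand I t"
    have "measure_pmf.expectation (run unirand I (Suc t)) (F (Suc t))
        = (\<Sum>c\<in>set_pmf ?p. pmf ?p c *\<^sub>R measure_pmf.expectation
            (map_pmf (\<lambda>z. c @ [z]) (unirand (take (Suc t) I) c)) (F (Suc t)))"
      unfolding run.simps
      by (intro pmf_expectation_bind) (auto simp: finite_set_pmf_run_unirand finite_set_pmf_unirand)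
    also have "\<dots> = (\<Sum>c\<in>set_pmf ?p. pmf ?p c *\<^sub>R F t c)"
      using expectation_unirand_step[of t I] Suc.prems by (simp add: F_def)
    also have "\<dots> = measure_pmf.expectation ?p (F t)"
      by (rule integral_measure_pmf[symmetric]) (auto simp: finite_set_pmf_run_unirand)
    finally show ?case using Suc by simp
  qed simp
  from this[of "length I"] have
    "measure_pmf.expectation (run unirand I (length I)) (F (length I)) = uniform_gain (active_sets I) UNIV"
    by (simp add: F_def)
  then show ?thesis by (simp add: expected_gain_def gain_def[abs_def] F_def)
qed

section \<open>Optimal solutions of decremental instances\<close>

lemma active_decremental_Suc:
  assumes "decremental I" "Suc t < length I"
  shows "active (take (Suc (Suc t)) I) \<subseteq> active (take (Suc t) I)"
proof -
  \<comment> \<open>Insertions are confined to the first batch, and index \<open>Suc t\<close> lies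
    beyond it.\<close>
  have "I ! Suc t \<in> set (tl I)" using assms(2) by (auto simp: nth_tl[symmetric] intro!: nth_mem)
  then have noins: "\<forall>x. Insert x \<notin> set (I ! Suc t)" using assms(1) by (simp add: decremental_def)
  have "fold apply_update us S \<subseteq> S" if "\<forall>x. Insert x \<notin> set us" for us and S :: "'a set"
    using that
  proof (induction us arbitrary: S)
    case (Cons u us)
    then show ?case by (cases u) (auto; blast)+
  qed simp
  with noins show ?thesis
    using assms(2) by (simp add: active_def take_Suc_conv_app_nth[of "Suc t"])
qed

lemma active_decremental_antimono:
  assumes "decremental I" "k \<le> t" "t < length I"
  shows "active (take (Suc t) I) \<subseteq> active (take (Suc k) I)"
  using assms(2,3)
proof (induction rule: dec_induct)
  case (step t)
  then show ?case using active_decremental_Suc[OF assms(1), of t] by auto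
qed simp

definition collection_order :: "'a option list \<Rightarrow> 'a list" where
  "collection_order c = map the (filter (\<lambda>z. z \<noteq> None) c)"

lemma set_collection_order: "set (collection_order c) = collected c"
  by (force simp: collection_order_def collected_def)

lemma distinct_collection_order:
  assumes "\<And>t x. t < length c \<Longrightarrow> c ! t = Some x \<Longrightarrow> x \<notin> collected (take t c)"
  shows "distinct (collection_order c)"
  using assms
proof (induction c rule: rev_induct)
  case (snoc z c)
  have "distinct (collection_order c)"
  proof (rule snoc.IH)
    show "x \<notin> collected (take t c)" if "t < length c" "c ! t = Some x" for t x
      using snoc.prems[of t x] that by (simp add: nth_append)
  qed
  moreover have "z = Some x \<Longrightarrow> x \<notin> set (collection_order c)" for x
    using snoc.prems[of "length c" x] by (simp add: set_collection_order)
  ultimately show ?case by (cases z) (auto simp: collection_order_def)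
qed (simp add: collection_order_def)

text \<open>Dropping idle steps can only move items to earlier positions.\<close>

lemma nth_collection_order:
  assumes "i < length (collection_order c)"
  shows "\<exists>t\<ge>i. t < length c \<and> c ! t = Some (collection_order c ! i)"
  using assms
proof (induction c arbitrary: i)
  case (Cons z c)
  show ?case
  proof (cases "z \<noteq> None \<and> i = 0")
    case True
    then show ?thesis by (intro exI[of _ 0]) (auto simp: collection_order_def)
  next
    case False
    define j where "j = (if z = None then i else i - 1)"
    have "j < length (collection_order c)" "collection_order (z # c) ! i = collection_order c ! j"
      using False Cons.prems by (auto simp: collection_order_def j_def nth_Cons split: nat.splits)
    with Cons.IH[of j] obtain t where
      "t \<ge> j" "t < length c" "c ! t = Some (collection_order (z # c) ! i)" by auto
    then show ?thesis by (intro exI[of _ "Suc t"]) (auto simp: j_def split: if_splits)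
  qed
qed (simp add: collection_order_def)

text \<open>The item at a position \<open>i >= k\<close> is collected at some step
  \<open>t >= i\<close>, so it is active then and, as nothing is inserted later, already at step
  \<open>k\<close>. This is the chain condition of \<open>uniform_gain_ge\<close>.\<close>

lemma feasible_collection_order:
  assumes dec: "decremental I" and c: "feasible I c"
    and k: "k < length (collection_order c)"
  shows "k < length (active_sets I) \<and> set (drop k (collection_order c)) \<subseteq> active_sets I ! k"
proof -
  have len: "length c = length I" using c by (simp add: feasible_def)
  have kI: "k < length I" using nth_collection_order[OF k] len by auto
  have "x \<in> active (take (Suc k) I)" if x: "x \<in> set (drop k (collection_order c))" for x
  proof -
    obtain i where i: "k \<le> i" "i < length (collection_order c)" "x = collection_order c ! i"
    proof -
      obtain j where "j < length (collection_order c) - k" "x = collection_order c ! (k + j)"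
        using x k by (auto simp: in_set_conv_nth)
      then show thesis by (intro that[of "k + j"]) auto
    qed
    then obtain t where t: "i \<le> t" "t < length I" "c ! t = Some x"
      using nth_collection_order[of i c] len by auto
    then have "x \<in> active (take (Suc t) I)" using c by (auto simp: feasible_def pending_def)
    then show ?thesis using active_decremental_antimono[OF dec, of k t] i t by auto
  qed
  with kI show ?thesis by auto
qed

theorem theorem2:
  "competitive_on {I :: 'a dyn_instance. decremental I} (\<lambda>_. 1) (exp 1 / (exp 1 - 1)) unirand"
proof -
  have "expected_gain (\<lambda>_. 1) unirand I \<ge> OPT (\<lambda>_. 1) I / (exp 1 / (exp 1 - 1))"
    if dec: "decremental I" for I :: "'a dyn_instance"
  proof -
    have "OPT (\<lambda>_. 1) I \<in> gain (\<lambda>_. 1) ` {c. feasible I c}"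
      unfolding OPT_def using finite_feasible[of I] feasible_idle[of I] by (intro Max_in) auto
    then obtain c where c: "feasible I c" and opt: "OPT (\<lambda>_. 1) I = real (card (collected c))"
      by (auto simp: gain_def)
    define xs where "xs = collection_order c"
    have dist: "distinct xs"
      unfolding xs_def using c
      by (intro distinct_collection_order) (auto simp: feasible_def pending_def)
    have "length xs = card (collected c)"
      using dist by (simp add: xs_def set_collection_order flip: distinct_card)
    \<comment> \<open>The reciprocal of the ratio is \<open>(e - 1) / e = 1 - 1 / e\<close>.\<close>
    then have "OPT (\<lambda>_. 1) I / (exp 1 / (exp 1 - 1)) = real (length xs) * (1 - exp (- 1))"
      by (simp add: opt exp_minus field_simps)
    also have "\<dots> \<le> uniform_gain (active_sets I) (set xs)"
      using feasible_collection_order[OF dec c, folded xs_def]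
      by (intro uniform_gain_ge finite_active_sets dist)
    \<comment> \<open>The algorithm also chooses among items outside the optimal solution; by
      monotonicity these do no harm.\<close>
    also have "\<dots> \<le> uniform_gain (active_sets I) UNIV"
      by (intro uniform_gain_mono finite_active_sets) simp
    finally show ?thesis by (simp add: expected_gain_unirand)
  qed
  then show ?thesis by (simp add: competitive_on_def online_algorithm_unirand)
qed

end
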